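(* Let $m<n$ be positive integers and let $U\subset\mathbb{R}^{m\times n}$ be the (open) set of $m\times n$ real matrices of full row rank $m$. For $v\in\mathbb{R}^n$ and $G\in U$ define $$p(v,G)=v-G^\top\lambda,\qquad\text{where }\lambda=\lambda(v,G)\in\mathbb{R}^m\text{ is the unique solution of } GG^\top\lambda=Gv.$$ Let $\ell:\mathbb{R}^n\to\mathbb{R}$ be differentiable and let $\mathcal{L}(v,G)=\ell(p(v,G))$. Fix $(v,G)\in\mathbb{R}^n\times U$, write $p=p(v,G)$, $\lambda=\lambda(v,G)$, $\bar p=\nabla\ell(p)\in\mathbb{R}^n$, and let $\mu\in\mathbb{R}^m$ be the unique solution of $GG^\top\mu=G\bar p$. Then the gradients $\bar v=\nabla_v\mathcal{L}(v,G)\in\mathbb{R}^n$ and $\bar G=\nabla_G\mathcal{L}(v,G)\in\mathbb{R}^{m\times n}$ are given by $$\bar v=\bar p-G^\top\mu,\qquad \bar G=-\mu\,p^\top-\lambda\,\bar v^\top.$$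
   Context: Vectors are column vectors. The gradient $\nabla_G\mathcal{L}$ is the $m\times n$ matrix of partial derivatives with entries $(\nabla_G\mathcal{L})_{ij}=\partial\mathcal{L}/\partial G_{ij}$, with $v$ held fixed; $\nabla_v\mathcal{L}$ is the usual gradient in $v$ with $G$ held fixed. *)

theory Defs
  imports "HOL-Analysis.Analysis"
begin

definition full_row_rank :: "(real^'n^'m) set" where
  "full_row_rank = {G. rank G = CARD('m)}"

lemma full_row_rank_normal_eq_ex1:
  fixes G :: "real^'n^'m"
  assumes "G \<in> full_row_rank"
  shows "\<exists>!l. (G ** transpose G) *v l = b"
proof -
  have inj: "inj ((*v) (transpose G))"
    using assms unfolding full_rank_injective[symmetric] rank_transpose full_row_rank_def by simp
  have "x = 0" if "(G ** transpose G) *v x = 0" for x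
  proof -
    have "(transpose G *v x) \<bullet> (transpose G *v x) = x \<bullet> (G *v (transpose G *v x))"
      by (simp only: transpose_matrix_vector dot_lmul_matrix)
    also have "\<dots> = 0"
      by (simp only: matrix_vector_mul_assoc that inner_zero_right)
    finally have "transpose G *v x = transpose G *v 0"
      by simp
    with inj show ?thesis by (rule injD)
  qed
  then obtain B where B: "B ** (G ** transpose G) = mat 1"
    using matrix_left_invertible_ker[of "G ** transpose G"] by auto
  then have "(G ** transpose G) ** B = mat 1"
    by (rule matrix_left_right_inverse[THEN iffD1])
  show ?thesis
  proof (rule ex1I[of _ "B *v b"])
    show "(G ** transpose G) *v (B *v b) = b"
      by (simp only: matrix_vector_mul_assoc \<open>(G ** transpose G) ** B = mat 1\<close> matrix_vector_mul_lid)
  next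
    fix l assume "(G ** transpose G) *v l = b"
    then have "B *v b = (B ** (G ** transpose G)) *v l"
      by (simp only: matrix_vector_mul_assoc[symmetric])
    then show "l = B *v b"
      by (simp only: B matrix_vector_mul_lid)
  qed
qed

text \<open>
  The multiplier is meaningful only for matrices of full row rank, where the defining equation has
  exactly one solution; elsewhere \<open>THE\<close> returns an unspecified vector.
\<close>

definition multiplier :: "real^'n \<Rightarrow> real^'n^'m \<Rightarrow> real^'m" where
  "multiplier v G = (THE l. (G ** transpose G) *v l = G *v v)"

definition null_proj :: "real^'n \<Rightarrow> real^'n^'m \<Rightarrow> real^'n" where
  "null_proj v G = v - transpose G *v multiplier v G"

definition outer_product :: "real^'m \<Rightarrow> real^'n \<Rightarrow> real^'n^'m" where
  "outer_product x y = (\<chi> i j. x $ i * y $ j)"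

text \<open>
  \<open>axis i (axis j t)\<close> is the matrix whose only possibly nonzero entry is \<open>t\<close>, in position \<open>(i, j)\<close>.
\<close>

definition has_matrix_gradient ::
    "(real^'n^'m \<Rightarrow> real) \<Rightarrow> real^'n^'m \<Rightarrow> real^'n^'m \<Rightarrow> bool" where
  "has_matrix_gradient F D G \<longleftrightarrow>
     (\<forall>i j. ((\<lambda>t. F (G + axis i (axis j t))) has_real_derivative D $ i $ j) (at 0))"

end

(*
  The image of null_proj v H is pinned down by the constraint H *v null_proj v H = 0.  Differentiating
  this constraint in H determines G *v dp, and the derivative of the multiplier, whose existence
  follows from Cramer's rule, enters dp only through the row space of G.  Splitting pbar into
  vbar, which lies in the kernel of G, and transpose G *v mu therefore evaluates pbar \<bullet> dp without
  computing the derivative of the multiplier.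
*)
theory Submission
  imports Defs
begin

lemma differentiable_prod:
  fixes f :: "'i \<Rightarrow> 'a::real_normed_vector \<Rightarrow> 'b::{real_normed_field}"
  assumes "\<And>i. i \<in> I \<Longrightarrow> f i differentiable (at x)"
  shows "(\<lambda>x. \<Prod>i\<in>I. f i x) differentiable (at x)"
proof -
  from assms obtain f' where "\<And>i. i \<in> I \<Longrightarrow> (f i has_derivative f' i) (at x)"
    unfolding differentiable_def by metis
  then show ?thesis
    unfolding differentiable_def by (blast intro: has_derivative_prod)
qed

text \<open>By the Leibniz formula a determinant is a finite sum of products of entries. This serves
  the Gram determinant as well as both determinants of Cramer's rule.\<close>

lemma differentiable_det:
  fixes A :: "'a::real_normed_vector \<Rightarrow> real^'m^'m"
  assumes "\<And>i j. (\<lambda>x. A x $ i $ j) differentiable (at x)"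
  shows "(\<lambda>x. det (A x)) differentiable (at x)"
  unfolding det_def
  by (intro differentiable_sum differentiable_mult differentiable_const differentiable_prod assms ballI)
    (simp add: finite_permutations)

lemma differentiable_vec_lambda:
  fixes f :: "'m::finite \<Rightarrow> 'a::euclidean_space \<Rightarrow> real"
  assumes "\<And>k. f k differentiable (at x)"
  shows "(\<lambda>x. \<chi> k. f k x) differentiable (at x)"
  using assms
  by (subst differentiable_componentwise_within) (auto simp: Basis_vec_def inner_axis)

lemma det_nonzero_iff_inj:
  fixes A :: "real^'m^'m"
  shows "det A \<noteq> 0 \<longleftrightarrow> inj ((*v) A)"
  using det_nz_iff_inj[OF matrix_vector_mul_linear[of A]] by simp

text \<open>Unique solvability of the normal equation makes the Gram matrix injective; conversely,
  the rank of a product is at most that of its left factor. The rank condition thus becomes the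
  nonvanishing of a polynomial in the entries, and that polynomial is also the denominator in
  Cramer's rule.\<close>

lemma full_row_rank_iff_det_nonzero:
  fixes G :: "real^'n^'m"
  shows "G \<in> full_row_rank \<longleftrightarrow> det (G ** transpose G) \<noteq> 0"
proof
  assume "G \<in> full_row_rank"
  then have "inj ((*v) (G ** transpose G))"
    using full_row_rank_normal_eq_ex1 by (metis injI)
  then show "det (G ** transpose G) \<noteq> 0"
    by (simp only: det_nonzero_iff_inj not_False_eq_True)
next
  assume "det (G ** transpose G) \<noteq> 0"
  then have "rank (G ** transpose G) = CARD('m)"
    by (simp only: det_nonzero_iff_inj full_rank_injective)
  then show "G \<in> full_row_rank"
    using rank_mul_le_left[of G "transpose G"] rank_bound[of G]
    by (simp add: full_row_rank_def)
qed

lemma inner_transpose_vector_mult: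
  "(x::real^'n) \<bullet> (transpose A *v y) = y \<bullet> (A *v x)"
  by (simp add: inner_commute[of x] dot_lmul_matrix)

lemma multiplier_normal_eq:
  assumes "G \<in> full_row_rank"
  shows "(G ** transpose G) *v multiplier v G = G *v v"
  unfolding multiplier_def by (rule theI') (rule full_row_rank_normal_eq_ex1[OF assms])

lemma multiplier_unique:
  assumes "G \<in> full_row_rank" "(G ** transpose G) *v l = G *v v"
  shows "l = multiplier v G"
  using full_row_rank_normal_eq_ex1[OF assms(1)] multiplier_normal_eq[OF assms(1)] assms(2)
  by metis

lemma matrix_mult_null_proj:
  assumes "G \<in> full_row_rank"
  shows "G *v null_proj v G = 0"
  using multiplier_normal_eq[OF assms, of v]
  by (simp add: null_proj_def matrix_vector_mult_diff_distrib matrix_vector_mul_assoc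
      del: transpose_matrix_vector)

lemma bounded_bilinear_matrix_vector_mult:
  "bounded_bilinear (\<lambda>(A::real^'n^'m) x. A *v x)"
  by (simp add: bilinear_conv_bounded_bilinear[symmetric] bilinear_def linear_iff
      matrix_vector_mult_add_rdistrib matrix_vector_right_distrib scaleR_matrix_vector_assoc
      matrix_vector_mult_scaleR)

lemma bounded_bilinear_transpose_vector_mult:
  "bounded_bilinear (\<lambda>(A::real^'n^'m) x. transpose A *v x)"
proof -
  have "linear (transpose :: real^'n^'m \<Rightarrow> _)"
    by (rule linearI) (simp_all add: transpose_def vec_eq_iff)
  then show ?thesis
    by (intro bounded_bilinear.comp1[OF bounded_bilinear_matrix_vector_mult]) (simp only: linear_conv_bounded_linear)
qed

lemma differentiable_entry: "(\<lambda>H::real^'n^'m. H $ i $ j) differentiable F"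
  by (intro bounded_linear_imp_differentiable bounded_linear_compose[OF bounded_linear_vec_nth]
      bounded_linear_vec_nth)

lemma differentiable_gram_entry:
  "(\<lambda>H::real^'n^'m. (H ** transpose H) $ i $ j) differentiable (at G)"
  by (simp add: matrix_matrix_mult_def transpose_def differentiable_entry)

lemma differentiable_matrix_vector_entry:
  "(\<lambda>H::real^'n^'m. (H *v v) $ i) differentiable (at G)"
  by (simp add: matrix_vector_mult_def differentiable_entry)

text \<open>Openness lets identities valid only for full row rank be differentiated at
  \<open>G\<close>.\<close>

lemma open_full_row_rank: "open (full_row_rank :: (real^'n^'m) set)"
proof -
  have "continuous_on UNIV (\<lambda>G::real^'n^'m. det (G ** transpose G))"
    by (intro differentiable_imp_continuous_on differentiable_at_imp_differentiable_on
        differentiable_det differentiable_gram_entry)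
  then have "open ((\<lambda>G::real^'n^'m. det (G ** transpose G)) -` (- {0}))"
    by (rule open_vimage[rotated]) auto
  moreover have "(\<lambda>G::real^'n^'m. det (G ** transpose G)) -` (- {0}) = full_row_rank"
    by (simp only: set_eq_iff full_row_rank_iff_det_nonzero vimage_eq Compl_iff singleton_iff simp_thms)
  ultimately show ?thesis
    by (simp only:)
qed

lemma differentiable_multiplier:
  fixes G :: "real^'n^'m"
  assumes G: "G \<in> full_row_rank"
  shows "multiplier v differentiable (at G)"
proof -
  \<comment> \<open>Cramer's quotients for the normal equation: column \<open>k\<close> of the Gram
    matrix is replaced by the right-hand side \<open>H *v v\<close>.\<close>
  let ?c = "\<lambda>H::real^'n^'m. \<chi> k. det (\<chi> i j. if j = k then (H *v v) $ i else (H ** transpose H) $ i $ j)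
                            / det (H ** transpose H)"
  have "?c differentiable (at G)"
  proof (intro differentiable_vec_lambda differentiable_divide differentiable_det differentiable_gram_entry)
    show "det (G ** transpose G) \<noteq> 0"
      using G full_row_rank_iff_det_nonzero by blast
    show "(\<lambda>H::real^'n^'m. (\<chi> i j. if j = k then (H *v v) $ i else (H ** transpose H) $ i $ j) $ i $ j)
        differentiable (at G)" for i j k :: 'm
      using differentiable_gram_entry differentiable_matrix_vector_entry by (cases "j = k") auto
  qed
  then obtain D where "(?c has_derivative D) (at G)"
    unfolding differentiable_def by blast
  then have "(multiplier v has_derivative D) (at G)"
  \<comment> \<open>The quotients are compared with \<open>multiplier v\<close> only on
    \<open>full_row_rank\<close>, a neighbourhood of \<open>G\<close>; the unspecified values of
    \<open>THE\<close> elsewhere do not affect the derivative.\<close>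
  proof (rule has_derivative_transform_within_open[OF _ open_full_row_rank G])
    fix H :: "real^'n^'m" assume H: "H \<in> full_row_rank"
    show "?c H = multiplier v H"
      by (rule cramer[THEN iffD1, OF H[unfolded full_row_rank_iff_det_nonzero] multiplier_normal_eq[OF H],
            symmetric])
  qed
  then show ?thesis
    unfolding differentiable_def by blast
qed

text \<open>For fixed \<open>G\<close> the map is the orthogonal projection onto the kernel of
  \<open>G\<close>, hence self-adjoint.\<close>

lemma inner_null_proj:
  fixes G :: "real^'n^'m"
  assumes G: "G \<in> full_row_rank"
  shows "x \<bullet> null_proj y G = null_proj x G \<bullet> y"
proof -
  \<comment> \<open>Both sides equal \<open>multiplier y G \<bullet> (G *v x)\<close>. The right
    side is symmetric in \<open>x\<close> and \<open>y\<close>, so exchanging them gives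
    self-adjointness of the row-space part.\<close>
  have *: "x \<bullet> (transpose G *v multiplier y G) =
      (transpose G *v multiplier x G) \<bullet> (transpose G *v multiplier y G)" for x y
    by (simp only: inner_transpose_vector_mult matrix_vector_mul_assoc multiplier_normal_eq[OF G])
  have "x \<bullet> (transpose G *v multiplier y G) = (transpose G *v multiplier x G) \<bullet> y"
    using *[of x y] *[of y x] by (metis inner_commute)
  then show ?thesis
    by (simp only: null_proj_def inner_diff)
qed

text \<open>Linearity follows from self-adjointness by testing against arbitrary vectors.\<close>

lemma bounded_linear_null_proj:
  fixes G :: "real^'n^'m"
  assumes G: "G \<in> full_row_rank"
  shows "bounded_linear (\<lambda>w. null_proj w G)"
proof (rule linear_conv_bounded_linear[THEN iffD1], rule linearI)
  show "null_proj (x + y) G = null_proj x G + null_proj y G" for x y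
    by (rule vector_eq_ldot[THEN iffD1]) (simp add: inner_null_proj[OF G] inner_add)
  show "null_proj (r *\<^sub>R x) G = r *\<^sub>R null_proj x G" for r x
    by (rule vector_eq_ldot[THEN iffD1]) (simp add: inner_null_proj[OF G])
qed

text \<open>The derivative is described by its pairing with an arbitrary \<open>q\<close>, a form
  free of the derivative of the multiplier. The gradient needs only \<open>q = pbar\<close>.\<close>

lemma null_proj_has_derivative:
  fixes G :: "real^'n^'m"
  assumes G: "G \<in> full_row_rank"
  shows "\<exists>P. (null_proj v has_derivative P) (at G) \<and>
    (\<forall>q E. q \<bullet> P E = - (multiplier q G \<bullet> (E *v null_proj v G)) - multiplier v G \<bullet> (E *v null_proj q G))"
proof -
  obtain D where D: "(multiplier v has_derivative D) (at G)"
    using differentiable_multiplier[OF G] unfolding differentiable_def by blast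
  \<comment> \<open>The product rule for \<open>v - transpose H *v multiplier v H\<close>;
    \<open>D\<close> enters only through the row space of \<open>G\<close>.\<close>
  define P where "P E = - (transpose G *v D E + transpose E *v multiplier v G)" for E
  have P: "(null_proj v has_derivative P) (at G)"
    using has_derivative_diff[OF has_derivative_const
        bounded_bilinear.FDERIV[OF bounded_bilinear_transpose_vector_mult has_derivative_ident D], of v]
    by (simp only: null_proj_def[abs_def] P_def[abs_def] diff_0)
  have "((\<lambda>H. H *v null_proj v H) has_derivative (\<lambda>E. G *v P E + E *v null_proj v G)) (at G)"
    by (rule bounded_bilinear.FDERIV[OF bounded_bilinear_matrix_vector_mult has_derivative_ident P])
  \<comment> \<open>The constraint holds on a whole neighbourhood of \<open>G\<close>, so its left
    side is locally constant; comparing the two derivatives yields \<open>GP\<close>.\<close>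
  moreover have "((\<lambda>H. H *v null_proj v H) has_derivative (\<lambda>E. 0)) (at G)"
    by (rule has_derivative_transform_within_open[OF has_derivative_const open_full_row_rank G])
      (simp add: matrix_mult_null_proj)
  ultimately have "(\<lambda>E. G *v P E + E *v null_proj v G) = (\<lambda>E. 0)"
    by (rule has_derivative_unique)
  then have GP: "G *v P E = - (E *v null_proj v G)" for E
    by (simp add: fun_eq_iff eq_neg_iff_add_eq_0)
  have "q \<bullet> P E = - (multiplier q G \<bullet> (E *v null_proj v G)) - multiplier v G \<bullet> (E *v null_proj q G)" for q E
  proof -
    have "q \<bullet> P E = (transpose G *v multiplier q G) \<bullet> P E + null_proj q G \<bullet> P E"
      by (simp add: null_proj_def inner_diff)
    also have "(transpose G *v multiplier q G) \<bullet> P E = - (multiplier q G \<bullet> (E *v null_proj v G))"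
      by (simp only: inner_commute[of _ "P E"] inner_transpose_vector_mult GP inner_minus_right)
    \<comment> \<open>Since \<open>null_proj q G\<close> lies in the kernel of \<open>G\<close>, it
      is orthogonal to \<open>transpose G *v D E\<close>; only the term with
      \<open>transpose E\<close> survives.\<close>
    also have "null_proj q G \<bullet> P E = - (multiplier v G \<bullet> (E *v null_proj q G))"
      by (simp only: P_def inner_minus_right inner_add_right inner_transpose_vector_mult matrix_mult_null_proj[OF G] inner_zero_right add_0_left)
    finally show ?thesis by simp
  qed
  with P show ?thesis by (intro exI conjI allI)
qed

lemma axis_axis_zero: "axis i (axis j 0) = 0"
  by simp

text \<open>Evaluating the bilinear pairing at a multiple of a matrix unit picks out one entry,
  which turns the directional derivatives into the outer products of the gradient.\<close>

lemma inner_outer_product_axis: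
  "x \<bullet> (axis i (axis j t) *v y) = t * outer_product x y $ i $ j"
proof -
  have "(axis i (axis j t) *v y) $ k = axis i (t * y $ j) $ k" for k
  proof -
    have "(axis i (axis j t) *v y) $ k = axis i (axis j t) $ k \<bullet> y"
      by (simp add: matrix_vector_mul_component)
    also have "\<dots> = axis i (t * y $ j) $ k"
      by (cases "k = i") (simp_all add: axis_def inner_axis'[unfolded axis_def])
    finally show ?thesis .
  qed
  then have "axis i (axis j t) *v y = axis i (t * y $ j)"
    by (simp add: vec_eq_iff)
  then show ?thesis
    by (simp add: inner_axis outer_product_def)
qed

theorem mainTheorem2:
  fixes ell :: "real^'n \<Rightarrow> real"
    and L :: "real^'n \<Rightarrow> real^'n^'m \<Rightarrow> real"
    and v p pbar :: "real^'n"
    and G :: "real^'n^'m"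
    and lam mu :: "real^'m"
  assumes "CARD('m) < CARD('n)"
    and "\<forall>x. ell differentiable (at x)"
    and "\<forall>w. \<forall>H \<in> full_row_rank. L w H = ell (null_proj w H)"
    and "G \<in> full_row_rank"
    and "p = null_proj v G"
    and "lam = multiplier v G"
    and "GDERIV ell p :> pbar"
    and "(G ** transpose G) *v mu = G *v pbar"
  shows "\<exists>vbar Gbar.
      GDERIV (\<lambda>w. L w G) v :> vbar \<and>
      has_matrix_gradient (\<lambda>H. L v H) Gbar G \<and>
      vbar = pbar - transpose G *v mu \<and>
      Gbar = - outer_product mu p - outer_product lam vbar"
proof -
  note L = assms(3) and G = assms(4)
  \<comment> \<open>The projected form of \<open>vbar\<close> is the one produced by both
    derivatives; identifying \<open>mu\<close> with the multiplier of \<open>pbar\<close> converts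
    it to the stated formula at the end.\<close>
  define vbar where "vbar = null_proj pbar G"
  define Gbar where "Gbar = - outer_product mu p - outer_product lam vbar"
  have mu: "mu = multiplier pbar G"
    by (rule multiplier_unique[OF G assms(8)])
  have ell: "(ell has_derivative (\<lambda>h. h \<bullet> pbar)) (at (null_proj v G))"
    using assms(5,7) by (simp add: gderiv_def)
  have LG: "(\<lambda>w. L w G) = (\<lambda>w. ell (null_proj w G))"
    using L G by blast
  have "((\<lambda>w. L w G) has_derivative (\<lambda>h. null_proj h G \<bullet> pbar)) (at v)"
    unfolding LG
    by (rule has_derivative_compose[where f = "\<lambda>w. null_proj w G" and x = v and g = ell and g' = "\<lambda>h. h \<bullet> pbar",
          OF bounded_linear_imp_has_derivative[OF bounded_linear_null_proj[OF G]] ell])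
  \<comment> \<open>Self-adjointness moves the projection from the increment onto
    \<open>pbar\<close>.\<close>
  then have v: "GDERIV (\<lambda>w. L w G) v :> vbar"
    by (simp only: gderiv_def vbar_def inner_null_proj[OF G])
  from null_proj_has_derivative[OF G, of v] obtain P
    where P: "(null_proj v has_derivative P) (at G)"
      and pair: "\<forall>q E. q \<bullet> P E = - (multiplier q G \<bullet> (E *v null_proj v G)) - multiplier v G \<bullet> (E *v null_proj q G)"
    by (elim exE conjE) (rule that)
  \<comment> \<open>\<open>L\<close> is prescribed only for full row rank, so openness is used again
    to replace it by the composition near \<open>G\<close>.\<close>
  have LvG: "(L v has_derivative (\<lambda>E. P E \<bullet> pbar)) (at G)"
  proof (rule has_derivative_transform_within_open[OF _ open_full_row_rank G])
    show "((\<lambda>H. ell (null_proj v H)) has_derivative (\<lambda>E. P E \<bullet> pbar)) (at G)"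
      by (rule has_derivative_compose[where f = "null_proj v" and x = G and g = ell and g' = "\<lambda>h. h \<bullet> pbar",
            OF P ell])
  qed (simp add: L)
  have "((\<lambda>t. L v (G + axis i (axis j t))) has_real_derivative Gbar $ i $ j) (at 0)" for i j
  proof -
    have "bounded_linear (\<lambda>t. axis i (axis j t) :: real^'n^'m)"
      by (intro linear_conv_bounded_linear[THEN iffD1] linearI) (auto simp: axis_def vec_eq_iff)
    then have "((\<lambda>t. G + axis i (axis j t)) has_derivative (\<lambda>t. axis i (axis j t))) (at 0)"
      by (auto intro!: derivative_eq_intros bounded_linear_imp_has_derivative)
    then have "((\<lambda>t. L v (G + axis i (axis j t))) has_derivative (\<lambda>t. P (axis i (axis j t)) \<bullet> pbar)) (at 0)"
      by (rule has_derivative_compose[where g = "L v" and g' = "\<lambda>E. P E \<bullet> pbar"])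
        (simp only: axis_axis_zero add_0_right LvG)
    \<comment> \<open>The pairing formula with \<open>q = pbar\<close> and \<open>E\<close> a
      multiple of a matrix unit gives the partial derivative in entry \<open>(i, j)\<close>.\<close>
    moreover have "(\<lambda>t. P (axis i (axis j t)) \<bullet> pbar) = (*) (Gbar $ i $ j)"
    proof
      fix t
      have "P (axis i (axis j t)) \<bullet> pbar = pbar \<bullet> P (axis i (axis j t))"
        by (rule inner_commute)
      also have "\<dots> = - (t * outer_product mu p $ i $ j) - t * outer_product lam vbar $ i $ j"
        by (simp only: pair[rule_format] inner_outer_product_axis vbar_def mu assms(5,6))
      also have "\<dots> = Gbar $ i $ j * t"
        by (simp add: Gbar_def algebra_simps)
      finally show "P (axis i (axis j t)) \<bullet> pbar = Gbar $ i $ j * t" .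
    qed
    ultimately show ?thesis
      by (simp only: has_field_derivative_def)
  qed
  then have "has_matrix_gradient (\<lambda>H. L v H) Gbar G"
    by (simp add: has_matrix_gradient_def)
  moreover have "vbar = pbar - transpose G *v mu"
    by (simp add: vbar_def null_proj_def mu)
  ultimately show ?thesis
    using v Gbar_def by blast
qed

end
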